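(* Let $q$ be an odd prime power with $q\ge 5$ and let $n\ge 2$ be an integer. Let $\mathcal{F}_{q,n}$ be the class of maps $F:\mathbb{F}_q\to\mathbb{F}_q$ defined in the context. Then the spectrum of $\mathcal{F}_{q,n}$ satisfies $$v(\mathcal{F}_{q,n})\subseteq \{2,3,\ldots,n+1,\ q-n,q-n+1,\ldots,q-2,\ q\}.$$
   Context: Construction of $\mathcal{F}_{q,n}$: for $a,b\in\mathbb{F}_q^*$ put $g(x)=ax+b$, and let $\mathbf{O}_n=\{x_1,\ldots,x_n\}$ be a set of $n$ distinct elements of $\mathbb{F}_q$ with $x_1=0$ and $x_n=-b/a$. Define the permutation $f$ of $\mathbb{F}_q$ by $f(x)=g(x)$ for $x\notin\mathbf{O}_n$, $f(x_i)=g(x_{i-1})$ for $2\le i\le n$, and $f(x_1)=g(x_n)=0$. Put $F(x)=f(x)+x$; equivalently $F(\delta)=(a+1)\delta+b$ for $\delta\notin\mathbf{O}_n$, $F(x_i)=ax_{i-1}+x_i+b$ for $2\le i\le n$, and $F(0)=0$. The class $\mathcal{F}_{q,n}$ consists of all such $F$ (identified with their reduced polynomials of degree $\le q-1$), as $a,b\in\mathbb{F}_q^*$ and $\mathbf{O}_n$ vary. The value set of $F$ is $V_F=\{F(c):c\in\mathbb{F}_q\}$, and the spectrum of a class $\mathcal{C}$ is $v(\mathcal{C})=\{|V_F|:F\in\mathcal{C}\}$. *)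

theory Defs
  imports Complex_Main "HOL-Library.Cardinality"
begin

text \<open>
  The field with q elements is a type of classes field and finite, with q its cardinality.
  The set \<open>{x 1, \<dots>, x n}\<close> comes with its enumeration x; only the values of x
  on \<open>{1..n}\<close> are relevant.
\<close>

definition orbit_enum :: "'a::field \<Rightarrow> 'a \<Rightarrow> nat \<Rightarrow> (nat \<Rightarrow> 'a) \<Rightarrow> bool" where
  "orbit_enum a b n x \<longleftrightarrow> inj_on x {1..n} \<and> x 1 = 0 \<and> x n = - b / a"

definition shifted_affine :: "'a::field \<Rightarrow> 'a \<Rightarrow> nat \<Rightarrow> (nat \<Rightarrow> 'a) \<Rightarrow> ('a \<Rightarrow> 'a) \<Rightarrow> bool" where
  "shifted_affine a b n x f \<longleftrightarrow>
     (\<forall>t. t \<notin> x ` {1..n} \<longrightarrow> f t = a * t + b) \<and>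
     (\<forall>i\<in>{2..n}. f (x i) = a * x (i - 1) + b) \<and>
     f (x 1) = a * x n + b"

text \<open>The conditions in \<open>shifted_affine\<close> determine f.\<close>

lemma shifted_affine_ex1:
  assumes "orbit_enum a b n x" "n \<ge> 2"
  shows "\<exists>!f. shifted_affine a b n x f"
proof (rule ex_ex1I)
  let ?k = "the_inv_into {1..n} x"
  let ?f = "\<lambda>t. if t \<notin> x ` {1..n} then a * t + b
                else if ?k t = 1 then a * x n + b else a * x (?k t - 1) + b"
  have inj: "inj_on x {1..n}"
    using assms by (simp add: orbit_enum_def)
  have k: "?k (x i) = i" if "i \<in> {1..n}" for i
    using the_inv_into_f_f[OF inj that] .
  have "?f (x i) = a * x (i - 1) + b" if "i \<in> {2..n}" for i
    using that k[of i] by auto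
  moreover have "?f (x 1) = a * x n + b"
    using assms k[of 1] by auto
  ultimately have "shifted_affine a b n x ?f"
    unfolding shifted_affine_def by simp
  then show "\<exists>f. shifted_affine a b n x f" by blast
next
  fix f g
  assume f: "shifted_affine a b n x f" and g: "shifted_affine a b n x g"
  show "f = g"
  proof
    fix t
    consider "t \<notin> x ` {1..n}" | "t = x 1" | i where "i \<in> {2..n}" "t = x i"
    proof (cases "t \<in> x ` {1..n}")
      case True
      then obtain i where i: "i \<in> {1..n}" "t = x i" by blast
      show ?thesis
        using that(2) that(3)[of i] i by (cases "i = 1") auto
    qed (use that in blast)
    then show "f t = g t"
      using f g by cases (auto simp: shifted_affine_def)
  qed
qed

definition F_class :: "nat \<Rightarrow> ('a::field \<Rightarrow> 'a) set" where
  "F_class n = {F. \<exists>a b x f. a \<noteq> 0 \<and> b \<noteq> 0 \<and> orbit_enum a b n x \<and>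
                      shifted_affine a b n x f \<and> F = (\<lambda>t. f t + t)}"

definition value_set :: "('a \<Rightarrow> 'a) \<Rightarrow> 'a set" where
  "value_set F = {F c | c. c \<in> UNIV}"

definition spectrum :: "('a \<Rightarrow> 'a) set \<Rightarrow> nat set" where
  "spectrum C = {card (value_set F) | F. F \<in> C}"

end

theory Submission imports Defs begin

text \<open>
  If \<open>a = -1\<close>, then \<open>F\<close> is constantly \<open>b\<close> off \<open>\<bold>O\<^sub>n\<close>, which leaves at most \<open>n + 1\<close> values, and
  both 0 and \<open>b\<close> occur unless \<open>n = q\<close>. If \<open>a \<noteq> -1\<close>, then \<open>F\<close> is injective off \<open>\<bold>O\<^sub>n\<close>, so there are at
  least \<open>q - n\<close> values. The number of values is never \<open>q - 1\<close>: as \<open>f\<close> is a permutation and the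
  elements of a field with more than two elements sum to 0, the values of \<open>F\<close> sum to 0 over the
  field; but if \<open>F\<close> took one value \<open>w\<close> twice and missed only \<open>u\<close>, this sum would be \<open>w - u \<noteq> 0\<close>.
\<close>

lemma sum_UNIV_eq_0_if_card_gt_2:
  assumes "CARD('a::{ring_1_no_zero_divisors,finite}) > 2"
  shows "\<Sum>(UNIV :: 'a set) = 0"
proof -
  have "card {0, 1 :: 'a} < CARD('a)"
    using assms by simp
  then have "{0, 1 :: 'a} \<noteq> UNIV"
    by (metis less_irrefl)
  then obtain c :: 'a where c: "c \<noteq> 0" "c \<noteq> 1"
    by blast
  have "inj ((*) c)"
    using c by (simp add: inj_def)
  then have "bij ((*) c)"
    by (simp add: bij_def finite_UNIV_inj_surj)
  then have "(\<Sum>t\<in>UNIV. c * t) = \<Sum>UNIV"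
    by (rule sum.reindex_bij_betw)
  then have "(c - 1) * \<Sum>UNIV = 0"
    by (simp add: left_diff_distrib sum_distrib_left[symmetric])
  with c show ?thesis by simp
qed

lemma card_image_neq_card_minus_1_if_sum_eq:
  fixes f :: "'a::cancel_comm_monoid_add \<Rightarrow> 'a"
  assumes A: "finite A" "A \<noteq> {}" and into: "f ` A \<subseteq> A" and sum: "sum f A = \<Sum>A"
  shows "card (f ` A) \<noteq> card A - 1"
proof
  assume card: "card (f ` A) = card A - 1"
  have card_pos: "0 < card A"
    using A by (simp add: card_gt_0_iff)
  have "card (A - f ` A) = 1"
    using A(1) into card card_pos by (simp add: card_Diff_subset)
  then obtain u where "A - f ` A = {u}"
    by (rule card_1_singletonE)
  with into have u: "u \<in> A" and image: "f ` A = A - {u}"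
    by blast+
  have "\<not> inj_on f A"
    using card card_pos by (auto dest: card_image)
  then obtain c d where collision: "c \<in> A" "d \<in> A" "c \<noteq> d" "f c = f d"
    unfolding inj_on_def by blast
  then have "f c \<in> f ` (A - {c})"
    by auto
  then have "f ` (A - {c}) = f ` A"
    using collision(1) by (metis image_insert insert_Diff insert_absorb)
  with image have image_remove: "f ` (A - {c}) = A - {u}"
    by simp
  then have inj: "inj_on f (A - {c})"
    using A(1) collision(1) u by (intro eq_card_imp_inj_on) auto
  have "f c + \<Sum>(A - {u}) = f c + sum f (A - {c})"
    using sum.reindex[OF inj, of "\<lambda>t. t"] image_remove by simp
  also have "\<dots> = sum f A"
    using A(1) collision(1) by (simp add: sum.remove)
  also have "\<dots> = u + \<Sum>(A - {u})"
    using A(1) u sum by (simp add: sum.remove)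
  finally have "f c = u" by simp
  with collision(1) image show False by blast
qed

lemma value_set_eq_range: "value_set F = range F"
  by (simp add: value_set_def full_SetCompr_eq)

lemma card_value_set_add_id_neq:
  fixes f :: "'a::{ring_1_no_zero_divisors,finite} \<Rightarrow> 'a"
  assumes bij: "bij f" and card: "CARD('a) > 2"
  shows "card (value_set (\<lambda>t. f t + t)) \<noteq> CARD('a) - 1"
  unfolding value_set_eq_range
proof (rule card_image_neq_card_minus_1_if_sum_eq)
  have "sum f UNIV = \<Sum>UNIV"
    using bij by (rule sum.reindex_bij_betw)
  then show "(\<Sum>t\<in>UNIV. f t + t) = \<Sum>UNIV"
    using sum_UNIV_eq_0_if_card_gt_2[OF card] by (simp add: sum.distrib)
qed auto

lemma surj_shifted_affine:
  assumes f: "shifted_affine a b n x f" and a: "a \<noteq> 0"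
  shows "surj f"
proof -
  have "a * t + b \<in> range f" for t
  proof (cases "t \<in> x ` {1..n}")
    case False
    then have "a * t + b = f t"
      using f by (simp add: shifted_affine_def)
    then show ?thesis by simp
  next
    case True
    then obtain i where "i \<in> {1..n}" "t = x i" by blast
    then have "a * t + b = f (x (if i = n then 1 else i + 1))"
      using f by (simp add: shifted_affine_def)
    then show ?thesis by simp
  qed
  from this[of "(y - b) / a" for y] show ?thesis
    using a by auto
qed

lemma bij_shifted_affine:
  fixes f :: "'a::{field,finite} \<Rightarrow> 'a"
  assumes "shifted_affine a b n x f" and "a \<noteq> 0"
  shows "bij f"
  using surj_shifted_affine[OF assms] by (simp add: bij_def finite_UNIV_surj_inj)

lemma shifted_affine_0:
  assumes "orbit_enum a b n x" and "shifted_affine a b n x f" and "a \<noteq> 0"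
  shows "f 0 = 0"
  using assms by (simp add: orbit_enum_def shifted_affine_def)

lemma shifted_affine_add_id_off_orbit:
  assumes "shifted_affine a b n x f" and "t \<notin> x ` {1..n}"
  shows "f t + t = (a + 1) * t + b"
  using assms by (simp add: shifted_affine_def algebra_simps)

lemma card_orbit_le: "card (x ` {1..n}) \<le> n"
  using card_image_le[of "{1..n}" x] by simp

lemma card_value_set_shifted_affine_ge:
  fixes f :: "'a::{field,finite} \<Rightarrow> 'a"
  assumes f: "shifted_affine a b n x f" and a: "a \<noteq> - 1"
  shows "CARD('a) - n \<le> card (value_set (\<lambda>t. f t + t))"
proof -
  let ?O = "x ` {1..n}"
  have "a + 1 \<noteq> 0"
    using a by (simp add: add_eq_0_iff2)
  then have inj: "inj_on (\<lambda>t. f t + t) (- ?O)"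
    by (intro inj_onI) (simp add: shifted_affine_add_id_off_orbit[OF f])
  have "CARD('a) - n \<le> CARD('a) - card ?O"
    using card_orbit_le[of x n] by simp
  also have "\<dots> \<le> card (- ?O)"
    by (simp add: Compl_eq_Diff_UNIV diff_card_le_card_Diff)
  also have "\<dots> = card ((\<lambda>t. f t + t) ` (- ?O))"
    using inj by (simp add: card_image)
  also have "\<dots> \<le> card (value_set (\<lambda>t. f t + t))"
    unfolding value_set_eq_range by (intro card_mono) auto
  finally show ?thesis .
qed

lemma card_value_set_shifted_affine_minus_1_le:
  assumes f: "shifted_affine (- 1) b n x f"
  shows "card (value_set (\<lambda>t. f t + t)) \<le> n + 1"
proof -
  let ?F = "\<lambda>t. f t + t" and ?O = "x ` {1..n}"
  have "value_set ?F \<subseteq> insert b (?F ` ?O)"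
    using shifted_affine_add_id_off_orbit[OF f] by (auto simp: value_set_eq_range)
  then have "card (value_set ?F) \<le> card (insert b (?F ` ?O))"
    by (intro card_mono) auto
  also have "\<dots> \<le> card (?F ` ?O) + 1"
    by (simp add: card_insert_if)
  also have "card (?F ` ?O) \<le> n"
    using card_orbit_le[of "?F \<circ> x" n] by (simp add: image_comp)
  finally show ?thesis by simp
qed

lemma card_value_set_shifted_affine_minus_1_ge_2:
  fixes f :: "'a::{field,finite} \<Rightarrow> 'a"
  assumes x: "orbit_enum (- 1) b n x" and f: "shifted_affine (- 1) b n x f"
    and b: "b \<noteq> 0" and n: "n < CARD('a)"
  shows "2 \<le> card (value_set (\<lambda>t. f t + t))"
proof -
  have "x ` {1..n} \<noteq> UNIV"
    using card_orbit_le[of x n] n by auto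
  then obtain t where "t \<notin> x ` {1..n}" by blast
  then have "b = f t + t"
    using shifted_affine_add_id_off_orbit[OF f] by simp
  moreover have "0 = f 0 + 0"
    using shifted_affine_0[OF x f] by simp
  ultimately have "{0, b} \<subseteq> value_set (\<lambda>t. f t + t)"
    unfolding value_set_def by blast
  then have "card {0, b} \<le> card (value_set (\<lambda>t. f t + t))"
    by (intro card_mono) auto
  with b show ?thesis by simp
qed

theorem theorem1:
  fixes q n :: nat
  assumes "CARD('a::{field,finite}) = q"
    and "odd q" and "q \<ge> 5" and "n \<ge> 2"
  shows "spectrum (F_class n :: ('a \<Rightarrow> 'a) set) \<subseteq> {2..n + 1} \<union> {q - n..q - 2} \<union> {q}"
proof
  fix k assume "k \<in> spectrum (F_class n :: ('a \<Rightarrow> 'a) set)"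
  then obtain a b :: 'a and x f where a: "a \<noteq> 0" and b: "b \<noteq> 0"
    and x: "orbit_enum a b n x" and f: "shifted_affine a b n x f"
    and k: "k = card (value_set (\<lambda>t. f t + t))"
    by (auto simp: spectrum_def F_class_def)
  have "k \<le> q"
    unfolding k assms(1)[symmetric] by (intro card_mono) auto
  moreover have "k \<noteq> q - 1"
    using card_value_set_add_id_neq[OF bij_shifted_affine[OF f a]] assms k by simp
  moreover have "k \<in> {2..n + 1} \<or> q - n \<le> k"
  proof (cases "a = - 1 \<and> n < q")
    case True
    then show ?thesis
      using card_value_set_shifted_affine_minus_1_le
        card_value_set_shifted_affine_minus_1_ge_2 x f b k assms(1) by auto
  next
    case False
    then show ?thesis
      using card_value_set_shifted_affine_ge[OF f] k assms(1) by auto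
  qed
  ultimately show "k \<in> {2..n + 1} \<union> {q - n..q - 2} \<union> {q}" by auto
qed

end
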